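(* Let $\mathbf{x}_1,\dots,\mathbf{x}_n\in\mathbb{R}^p$ with $\|\mathbf{x}_i\|\le R$, let $\mathbf{y}\in\{-1,1\}^n$, let $\mathcal{P}=\{i:y_i=1\}$ and $\mathcal{N}=\{j:y_j=-1\}$ both be nonempty, and let $m=|\mathcal{P}||\mathcal{N}|$. Let $$R_{\mathrm{emp}}(\mathbf{w})=\frac1m\max_{\mathbf{z}\in\{-1,1\}^{\mathcal{P}\times\mathcal{N}}}\sum_{i\in\mathcal{P},\,j\in\mathcal{N}}\Big[\tfrac12(1-z_{ij})+z_{ij}\mathbf{w}^\top(\mathbf{x}_i-\mathbf{x}_j)\Big],\qquad\mathbf{w}\in\mathbb{R}^p.$$ Let $g(\boldsymbol\beta)=\frac1{2m}\sum_{i\in\mathcal{P},j\in\mathcal{N}}\beta_{ij}$ for $\boldsymbol\beta\in[-1,1]^{\mathcal{P}\times\mathcal{N}}$ and $g(\boldsymbol\beta)=+\infty$ elsewhere, and let $A$ be the $p\times m$ matrix whose $(i,j)$-th column is $\frac1m(\mathbf{x}_i-\mathbf{x}_j)$, $(i,j)\in\mathcal{P}\times\mathcal{N}$. Then $$R_{\mathrm{emp}}(\mathbf{w})=\tfrac12+g^\star(A^\top\mathbf{w})\quad\text{for all }\mathbf{w}\in\mathbb{R}^p,$$ and, with $d(\boldsymbol\beta)=\frac12\sum_{i,j}\beta_{ij}^2$ and $D=\max_{\boldsymbol\beta\in[-1,1]^{\mathcal{P}\times\mathcal{N}}}d(\boldsymbol\beta)$, $$\sqrt{D}\,\|A\|\le\sqrt2\,R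 .$$
   Context: $g^\star(\mathbf{u})=\sup_{\boldsymbol\beta}\{\langle\boldsymbol\beta,\mathbf{u}\rangle-g(\boldsymbol\beta)\}$ is the Fenchel dual; $\|\cdot\|$ on vectors is the Euclidean norm and $\|A\|=\max_{\|\mathbf{w}\|=\|\boldsymbol\beta\|=1}\mathbf{w}^\top A\boldsymbol\beta$. *)

theory Defs
  imports "HOL-Analysis.Analysis"
begin

text \<open>
  An attained maximum rather than a supremum: unspecified if \<open>f ` S\<close> has no greatest element.
\<close>

definition max_over :: "('b \<Rightarrow> real) \<Rightarrow> 'b set \<Rightarrow> real" where
  "max_over f S = (GREATEST t. t \<in> f ` S)"

text \<open>
  For a finite index set \<open>I\<close>, the space of vectors with coordinates in \<open>I\<close> is
  \<open>I \<rightarrow>\<^sub>E UNIV\<close>, with Euclidean norm \<open>L2_set _ I\<close>; a matrix with \<open>CARD('p)\<close> rows and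
  columns labelled by \<open>I\<close> is the family of its columns.
\<close>

definition fenchel_dual :: "'i set \<Rightarrow> (('i \<Rightarrow> real) \<Rightarrow> ereal) \<Rightarrow> ('i \<Rightarrow> real) \<Rightarrow> ereal" where
  "fenchel_dual I g u =
     (SUP \<beta> \<in> I \<rightarrow>\<^sub>E UNIV. ereal (\<Sum>k\<in>I. \<beta> k * u k) - g \<beta>)"

definition mat_vec :: "'i set \<Rightarrow> ('i \<Rightarrow> real ^ 'p) \<Rightarrow> ('i \<Rightarrow> real) \<Rightarrow> real ^ 'p" where
  "mat_vec I A \<beta> = (\<Sum>k\<in>I. \<beta> k *\<^sub>R A k)"

definition transpose_vec :: "'i set \<Rightarrow> ('i \<Rightarrow> real ^ 'p) \<Rightarrow> real ^ 'p \<Rightarrow> ('i \<Rightarrow> real)" where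
  "transpose_vec I A w = (\<lambda>k\<in>I. A k \<bullet> w)"

definition mat_norm :: "'i set \<Rightarrow> ('i \<Rightarrow> real ^ 'p) \<Rightarrow> real" where
  "mat_norm I A =
     max_over (\<lambda>(w, \<beta>). w \<bullet> mat_vec I A \<beta>)
       {(w, \<beta>). norm w = 1 \<and> \<beta> \<in> I \<rightarrow>\<^sub>E UNIV \<and> L2_set \<beta> I = 1}"

definition pos_idx :: "nat \<Rightarrow> (nat \<Rightarrow> real) \<Rightarrow> nat set" where
  "pos_idx n y = {i \<in> {1..n}. y i = 1}"

definition neg_idx :: "nat \<Rightarrow> (nat \<Rightarrow> real) \<Rightarrow> nat set" where
  "neg_idx n y = {j \<in> {1..n}. y j = -1}"

definition pairs :: "nat \<Rightarrow> (nat \<Rightarrow> real) \<Rightarrow> (nat \<times> nat) set" where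
  "pairs n y = pos_idx n y \<times> neg_idx n y"

definition num_pairs :: "nat \<Rightarrow> (nat \<Rightarrow> real) \<Rightarrow> nat" where
  "num_pairs n y = card (pos_idx n y) * card (neg_idx n y)"

definition R_emp :: "nat \<Rightarrow> (nat \<Rightarrow> real ^ 'p) \<Rightarrow> (nat \<Rightarrow> real) \<Rightarrow> real ^ 'p \<Rightarrow> real" where
  "R_emp n x y w =
     1 / real (num_pairs n y) *
     max_over (\<lambda>z. \<Sum>(i, j)\<in>pairs n y. (1 - z (i, j)) / 2 + z (i, j) * (w \<bullet> (x i - x j)))
       (pairs n y \<rightarrow>\<^sub>E {-1, 1})"

definition g_fun :: "nat \<Rightarrow> (nat \<Rightarrow> real) \<Rightarrow> (nat \<times> nat \<Rightarrow> real) \<Rightarrow> ereal" where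
  "g_fun n y \<beta> =
     (if \<beta> \<in> pairs n y \<rightarrow>\<^sub>E {-1..1}
      then ereal (1 / (2 * real (num_pairs n y)) * (\<Sum>k\<in>pairs n y. \<beta> k))
      else \<infinity>)"

definition A_mat :: "nat \<Rightarrow> (nat \<Rightarrow> real ^ 'p) \<Rightarrow> (nat \<Rightarrow> real) \<Rightarrow> nat \<times> nat \<Rightarrow> real ^ 'p" where
  "A_mat n x y = (\<lambda>(i, j)\<in>pairs n y. (1 / real (num_pairs n y)) *\<^sub>R (x i - x j))"

definition d_fun :: "nat \<Rightarrow> (nat \<Rightarrow> real) \<Rightarrow> (nat \<times> nat \<Rightarrow> real) \<Rightarrow> real" where
  "d_fun n y \<beta> = 1 / 2 * (\<Sum>k\<in>pairs n y. (\<beta> k)\<^sup>2)"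

definition D_max :: "nat \<Rightarrow> (nat \<Rightarrow> real) \<Rightarrow> real" where
  "D_max n y = max_over (d_fun n y) (pairs n y \<rightarrow>\<^sub>E {-1..1})"

end

theory Submission
  imports Defs
begin

text \<open>
  With \<open>c\<^sub>k = w \<bullet> (x\<^sub>i - x\<^sub>j)\<close> for \<open>k = (i, j)\<close>, the empirical risk and the Fenchel dual both
  maximise \<open>(1/m) \<Sum>\<^sub>k b\<^sub>k (c\<^sub>k - 1/2)\<close>, the former over sign vectors and the latter over the cube.
  A linear form has the same maximum, \<open>(1/m) \<Sum>\<^sub>k \<bar>c\<^sub>k - 1/2\<bar>\<close>, on both.
  For the second claim, \<open>D = m/2\<close>, while \<open>\<parallel>A\<parallel>\<close> is at most the Frobenius norm of \<open>A\<close>, whose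
  \<open>m\<close> columns have length at most \<open>2R/m\<close>.
\<close>

lemma max_over_eqI:
  assumes "s \<in> S" and "f s = t" and "\<And>s. s \<in> S \<Longrightarrow> f s \<le> t"
  shows "max_over f S = t"
  unfolding max_over_def using assms by (intro Greatest_equality) auto

text \<open>The coordinates of \<open>z\<close> are free of one another, so each summand is
  maximised separately by the sign of \<open>a k\<close>; where \<open>a k = 0\<close> the witness
  takes 1, to remain a sign vector.\<close>

lemma max_over_affine_sign:
  "max_over (\<lambda>z. c + (\<Sum>k\<in>I. z k * a k)) (I \<rightarrow>\<^sub>E {-1, 1}) = c + (\<Sum>k\<in>I. \<bar>a k\<bar>)"
proof (rule max_over_eqI)
  let ?z = "\<lambda>k\<in>I. if 0 \<le> a k then 1 else -1 :: real"
  show "?z \<in> I \<rightarrow>\<^sub>E {-1, 1}" by auto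
  show "c + (\<Sum>k\<in>I. ?z k * a k) = c + (\<Sum>k\<in>I. \<bar>a k\<bar>)"
    by (intro arg_cong2[of _ _ _ _ "(+)"] sum.cong) auto
next
  fix z :: "'a \<Rightarrow> real" assume z: "z \<in> I \<rightarrow>\<^sub>E {-1, 1}"
  have "(\<Sum>k\<in>I. z k * a k) \<le> (\<Sum>k\<in>I. \<bar>a k\<bar>)"
  proof (rule sum_mono)
    fix k assume "k \<in> I"
    then have "z k \<in> {-1, 1}" using z by (rule PiE_mem[rotated])
    then show "z k * a k \<le> \<bar>a k\<bar>" by auto
  qed
  then show "c + (\<Sum>k\<in>I. z k * a k) \<le> c + (\<Sum>k\<in>I. \<bar>a k\<bar>)" by simp
qed

text \<open>The value \<infinity> off the cube confines the supremum to it. There the objective is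
  linear with coefficients \<open>u k - b k\<close>, so it is bounded termwise and the bound is
  attained at a vertex.\<close>

lemma fenchel_dual_linear_on_cube:
  assumes "\<And>\<beta>. \<beta> \<in> I \<rightarrow>\<^sub>E {-1..1} \<Longrightarrow> g \<beta> = ereal (\<Sum>k\<in>I. \<beta> k * b k)"
    and "\<And>\<beta>. \<beta> \<notin> I \<rightarrow>\<^sub>E {-1..1} \<Longrightarrow> g \<beta> = \<infinity>"
  shows "fenchel_dual I g u = ereal (\<Sum>k\<in>I. \<bar>u k - b k\<bar>)"
  unfolding fenchel_dual_def
proof (rule antisym)
  show "(SUP \<beta> \<in> I \<rightarrow>\<^sub>E UNIV. ereal (\<Sum>k\<in>I. \<beta> k * u k) - g \<beta>)
      \<le> ereal (\<Sum>k\<in>I. \<bar>u k - b k\<bar>)"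
  proof (rule SUP_least)
    fix \<beta> :: "'a \<Rightarrow> real"
    show "ereal (\<Sum>k\<in>I. \<beta> k * u k) - g \<beta> \<le> ereal (\<Sum>k\<in>I. \<bar>u k - b k\<bar>)"
    proof (cases "\<beta> \<in> I \<rightarrow>\<^sub>E {-1..1}")
      case True
      have "(\<Sum>k\<in>I. \<beta> k * (u k - b k)) \<le> (\<Sum>k\<in>I. \<bar>u k - b k\<bar>)"
      proof (rule sum_mono)
        fix k assume "k \<in> I"
        then have "\<beta> k \<in> {-1..1}" using True by (rule PiE_mem[rotated])
        then have "\<bar>\<beta> k\<bar> \<le> 1" by auto
        then have "\<bar>\<beta> k\<bar> * \<bar>u k - b k\<bar> \<le> 1 * \<bar>u k - b k\<bar>" by (intro mult_right_mono) auto
        then show "\<beta> k * (u k - b k) \<le> \<bar>u k - b k\<bar>"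
          using abs_ge_self[of "\<beta> k * (u k - b k)"] by (simp add: abs_mult)
      qed
      then show ?thesis
        using True by (simp add: assms(1) right_diff_distrib sum_subtractf)
    \<comment> \<open>Off the cube the term is -\<infinity>.\<close>
    qed (simp add: assms(2))
  qed
next
  let ?\<beta> = "\<lambda>k\<in>I. if b k \<le> u k then 1 else -1 :: real"
  have "(\<Sum>k\<in>I. \<bar>u k - b k\<bar>) = (\<Sum>k\<in>I. ?\<beta> k * (u k - b k))"
    by (intro sum.cong) auto
  also have "\<dots> = (\<Sum>k\<in>I. ?\<beta> k * u k) - (\<Sum>k\<in>I. ?\<beta> k * b k)"
    by (simp only: right_diff_distrib sum_subtractf)
  finally have "ereal (\<Sum>k\<in>I. \<bar>u k - b k\<bar>) = ereal (\<Sum>k\<in>I. ?\<beta> k * u k) - g ?\<beta>"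
    by (subst assms(1)) auto
  also have "\<dots> \<le> (SUP \<beta> \<in> I \<rightarrow>\<^sub>E UNIV. ereal (\<Sum>k\<in>I. \<beta> k * u k) - g \<beta>)"
    by (rule SUP_upper) auto
  finally show "ereal (\<Sum>k\<in>I. \<bar>u k - b k\<bar>)
      \<le> (SUP \<beta> \<in> I \<rightarrow>\<^sub>E UNIV. ereal (\<Sum>k\<in>I. \<beta> k * u k) - g \<beta>)" .
qed

lemma inner_mat_vec: "w \<bullet> mat_vec I A \<beta> = (\<Sum>k\<in>I. \<beta> k * (A k \<bullet> w))"
  by (simp add: mat_vec_def inner_sum_right inner_commute)

text \<open>Moving the matrix to the other side gives the inner product of \<open>\<beta>\<close>
  with the transpose applied to \<open>w\<close>; Cauchy--Schwarz then separates the two.\<close>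

lemma inner_mat_vec_le: "w \<bullet> mat_vec I A \<beta> \<le> L2_set \<beta> I * L2_set (\<lambda>k. A k \<bullet> w) I"
proof -
  have "w \<bullet> mat_vec I A \<beta> \<le> (\<Sum>k\<in>I. \<bar>\<beta> k\<bar> * \<bar>A k \<bullet> w\<bar>)"
    unfolding inner_mat_vec by (intro sum_mono) (simp add: abs_mult[symmetric])
  also have "\<dots> \<le> L2_set \<beta> I * L2_set (\<lambda>k. A k \<bullet> w) I"
    by (rule L2_set_mult_ineq)
  finally show ?thesis .
qed

text \<open>Cauchy--Schwarz is attained; for \<open>v = 0\<close> any unit vector serves, whence \<open>I \<noteq> {}\<close>.\<close>

lemma L2_set_dual_unit_vector:
  assumes "finite I" and "I \<noteq> {}"
  obtains \<beta> where "\<beta> \<in> I \<rightarrow>\<^sub>E UNIV" and "L2_set \<beta> I = 1"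
    and "(\<Sum>k\<in>I. \<beta> k * v k) = L2_set v I"
proof (cases "L2_set v I = 0")
  case True
  obtain i where i: "i \<in> I" using assms(2) by auto
  let ?\<beta> = "\<lambda>k\<in>I. if k = i then 1 else 0 :: real"
  have v: "\<And>k. k \<in> I \<Longrightarrow> v k = 0" using True assms(1) by (simp add: L2_set_eq_0_iff)
  have "(\<Sum>k\<in>I. (?\<beta> k)\<^sup>2) = (\<Sum>k\<in>I. if k = i then 1 else 0)"
    by (intro sum.cong) auto
  then have "L2_set ?\<beta> I = 1" using i assms(1) by (simp add: L2_set_def)
  moreover have "(\<Sum>k\<in>I. ?\<beta> k * v k) = L2_set v I"
    unfolding True by (intro sum.neutral) (simp add: v)
  ultimately show ?thesis by (intro that[of ?\<beta>]) auto
next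
  case False
  let ?\<beta> = "\<lambda>k\<in>I. v k / L2_set v I"
  have sq: "(\<Sum>k\<in>I. (v k)\<^sup>2) = (L2_set v I)\<^sup>2"
    by (simp add: L2_set_def sum_nonneg)
  have "(\<Sum>k\<in>I. (?\<beta> k)\<^sup>2) = (\<Sum>k\<in>I. (v k)\<^sup>2) / (L2_set v I)\<^sup>2"
    unfolding sum_divide_distrib by (intro sum.cong) (auto simp: power_divide)
  then have "L2_set ?\<beta> I = 1" using False by (simp add: L2_set_def[of ?\<beta>] sq)
  moreover have "(\<Sum>k\<in>I. ?\<beta> k * v k) = (\<Sum>k\<in>I. (v k)\<^sup>2) / L2_set v I"
    unfolding sum_divide_distrib by (intro sum.cong) (auto simp: power2_eq_square)
  then have "(\<Sum>k\<in>I. ?\<beta> k * v k) = L2_set v I"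
    unfolding sq using False by (simp add: power2_eq_square)
  ultimately show ?thesis by (intro that[of ?\<beta>]) auto
qed

text \<open>
  Eliminating \<open>\<beta>\<close> first leaves a continuous function on the compact unit sphere of
  \<open>real ^ 'p\<close>, so that no topology on \<open>I \<rightarrow>\<^sub>E UNIV\<close> is needed for the maximum to exist.
\<close>

lemma mat_norm_attained:
  fixes A :: "'i \<Rightarrow> real ^ 'p"
  assumes "finite I" and "I \<noteq> {}"
  obtains w where "norm w = 1" and "mat_norm I A = L2_set (\<lambda>k. A k \<bullet> w) I"
proof -
  let ?h = "\<lambda>w. L2_set (\<lambda>k. A k \<bullet> w) I"
  \<comment> \<open>Types are inhabited, so \<open>undefined\<close> is some coordinate and its axis
    a unit vector.\<close>
  have "axis undefined 1 \<in> sphere (0 :: real ^ 'p) 1" by (simp add: norm_axis_1)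
  then have "sphere (0 :: real ^ 'p) 1 \<noteq> {}" by blast
  moreover have "continuous_on (sphere 0 1) ?h"
    unfolding L2_set_def by (intro continuous_intros)
  ultimately obtain w where w: "norm w = 1" and max: "\<And>v. norm v = 1 \<Longrightarrow> ?h v \<le> ?h w"
    using continuous_attains_sup[of "sphere 0 1" ?h] by auto
  \<comment> \<open>Aligning \<open>\<beta>\<close> with the transpose applied to \<open>w\<close>
    makes the pair \<open>(w, \<beta>)\<close> a joint maximiser.\<close>
  obtain \<beta> where \<beta>: "\<beta> \<in> I \<rightarrow>\<^sub>E UNIV" "L2_set \<beta> I = 1" "(\<Sum>k\<in>I. \<beta> k * (A k \<bullet> w)) = ?h w"
    using L2_set_dual_unit_vector[OF assms] by metis
  have "mat_norm I A = ?h w"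
    unfolding mat_norm_def
  proof (rule max_over_eqI[of "(w, \<beta>)"])
    show "(case (w, \<beta>) of (w, \<beta>) \<Rightarrow> w \<bullet> mat_vec I A \<beta>) = ?h w"
      using \<beta>(3) by (simp add: inner_mat_vec)
  next
    fix s :: "(real ^ 'p) \<times> ('i \<Rightarrow> real)"
    assume "s \<in> {(w, \<beta>). norm w = 1 \<and> \<beta> \<in> I \<rightarrow>\<^sub>E UNIV \<and> L2_set \<beta> I = 1}"
    then obtain v \<gamma> where s: "s = (v, \<gamma>)" "norm v = 1" "L2_set \<gamma> I = 1" by auto
    have "v \<bullet> mat_vec I A \<gamma> \<le> ?h v" using inner_mat_vec_le[of v I A \<gamma>] s(3) by simp
    with max[OF s(2)] show "(case s of (w, \<beta>) \<Rightarrow> w \<bullet> mat_vec I A \<beta>) \<le> ?h w"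
      by (simp add: s(1))
  qed (use w \<beta> in auto)
  with w that show ?thesis by blast
qed

text \<open>The norm is the length of the transpose applied to some unit \<open>w\<close>, a vector
  with \<open>card I\<close> coordinates, each at most \<open>c\<close> in absolute value by
  Cauchy--Schwarz.\<close>

lemma mat_norm_le:
  fixes A :: "'i \<Rightarrow> real ^ 'p"
  assumes "finite I" and "I \<noteq> {}" and "\<And>k. k \<in> I \<Longrightarrow> norm (A k) \<le> c"
  shows "mat_norm I A \<le> sqrt (real (card I)) * c"
proof -
  obtain w where w: "norm w = 1" "mat_norm I A = L2_set (\<lambda>k. A k \<bullet> w) I"
    using mat_norm_attained[OF assms(1,2)] .
  \<comment> \<open>The sign is needed at the end, where the square root of \<open>c\<^sup>2\<close>
    must be \<open>c\<close>.\<close>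
  have c: "0 \<le> c" using assms(2,3) norm_ge_zero order_trans by blast
  have "(\<Sum>k\<in>I. (A k \<bullet> w)\<^sup>2) \<le> (\<Sum>k\<in>I. c\<^sup>2)"
  proof (rule sum_mono)
    fix k assume "k \<in> I"
    then have "\<bar>A k \<bullet> w\<bar> \<le> c"
      using Cauchy_Schwarz_ineq2[of "A k" w] assms(3)[of k] w(1) by simp
    then show "(A k \<bullet> w)\<^sup>2 \<le> c\<^sup>2"
      using power_mono[of "\<bar>A k \<bullet> w\<bar>" c 2] by simp
  qed
  then have "L2_set (\<lambda>k. A k \<bullet> w) I \<le> sqrt (real (card I) * c\<^sup>2)"
    unfolding L2_set_def by simp
  then show ?thesis using w(2) c by (simp add: real_sqrt_mult)
qed

lemma D_max_eq:
  "D_max n y = real (card (pairs n y)) / 2"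
  unfolding D_max_def
proof (rule max_over_eqI)
  show "(\<lambda>k\<in>pairs n y. 1) \<in> pairs n y \<rightarrow>\<^sub>E {-1..1 :: real}" by auto
  show "d_fun n y (\<lambda>k\<in>pairs n y. 1) = real (card (pairs n y)) / 2"
    by (simp add: d_fun_def)
next
  fix \<beta> assume \<beta>: "\<beta> \<in> pairs n y \<rightarrow>\<^sub>E {-1..1 :: real}"
  have "(\<Sum>k\<in>pairs n y. (\<beta> k)\<^sup>2) \<le> (\<Sum>k\<in>pairs n y. 1)"
  proof (rule sum_mono)
    fix k assume "k \<in> pairs n y"
    then have "\<beta> k \<in> {-1..1}" using \<beta> by (rule PiE_mem[rotated])
    then show "(\<beta> k)\<^sup>2 \<le> 1" by (auto simp: abs_square_le_1)
  qed
  then show "d_fun n y \<beta> \<le> real (card (pairs n y)) / 2" by (simp add: d_fun_def)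
qed

lemma finite_pairs: "finite (pairs n y)"
  by (simp add: pairs_def pos_idx_def neg_idx_def)

lemma card_pairs: "card (pairs n y) = num_pairs n y"
  by (simp add: pairs_def num_pairs_def card_cartesian_product)

text \<open>Each summand is 1/2 plus \<open>z k\<close> times its coefficient. The halves add up to
  m/2, which division by m > 0 turns into the leading 1/2.\<close>

lemma R_emp_eq:
  assumes "pairs n y \<noteq> {}"
  shows "R_emp n x y w = 1 / 2
    + (\<Sum>(i, j)\<in>pairs n y. \<bar>w \<bullet> (x i - x j) - 1 / 2\<bar>) / real (num_pairs n y)"
proof -
  let ?P = "pairs n y" and ?m = "real (num_pairs n y)"
  let ?a = "\<lambda>(i, j). w \<bullet> (x i - x j) - 1 / 2"
  have m: "?m > 0"
    using assms finite_pairs[of n y] by (simp add: card_pairs[symmetric] card_gt_0_iff)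
  have split: "(\<Sum>(i, j)\<in>?P. (1 - z (i, j)) / 2 + z (i, j) * (w \<bullet> (x i - x j)))
      = ?m / 2 + (\<Sum>k\<in>?P. z k * ?a k)" for z
  proof -
    have "(\<Sum>(i, j)\<in>?P. (1 - z (i, j)) / 2 + z (i, j) * (w \<bullet> (x i - x j)))
        = (\<Sum>k\<in>?P. 1 / 2 + z k * ?a k)"
      by (intro sum.cong) (auto simp: field_simps)
    then show ?thesis by (simp add: sum.distrib card_pairs)
  qed
  have "max_over (\<lambda>z. ?m / 2 + (\<Sum>k\<in>?P. z k * ?a k)) (?P \<rightarrow>\<^sub>E {-1, 1})
      = ?m / 2 + (\<Sum>k\<in>?P. \<bar>?a k\<bar>)"
    by (rule max_over_affine_sign)
  then show ?thesis
    using m unfolding R_emp_def split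
    by (simp add: case_prod_beta add_divide_distrib)
qed

theorem mainTheorem3:
  fixes n :: nat and x :: "nat \<Rightarrow> real ^ 'p" and y :: "nat \<Rightarrow> real" and R :: real
  assumes "\<And>i. i \<in> {1..n} \<Longrightarrow> norm (x i) \<le> R"
    and "\<And>i. i \<in> {1..n} \<Longrightarrow> y i \<in> {-1, 1}"
    and "pos_idx n y \<noteq> {}"
    and "neg_idx n y \<noteq> {}"
  shows "(\<forall>w. ereal (R_emp n x y w) =
            ereal (1 / 2) + fenchel_dual (pairs n y) (g_fun n y)
                              (transpose_vec (pairs n y) (A_mat n x y) w))
       \<and> sqrt (D_max n y) * mat_norm (pairs n y) (A_mat n x y) \<le> sqrt 2 * R"
proof (intro conjI allI)
  let ?P = "pairs n y" and ?m = "real (num_pairs n y)"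
  have P: "?P \<noteq> {}" using assms(3,4) by (auto simp: pairs_def)
  have m: "?m > 0"
    using P finite_pairs[of n y] by (simp add: card_pairs[symmetric] card_gt_0_iff)
  {
    fix w
    let ?u = "transpose_vec ?P (A_mat n x y) w"
    \<comment> \<open>On the cube \<open>g_fun\<close> is the linear form whose coefficients all
      equal 1/(2m).\<close>
    have "fenchel_dual ?P (g_fun n y) ?u = ereal (\<Sum>k\<in>?P. \<bar>?u k - 1 / (2 * ?m)\<bar>)"
      by (rule fenchel_dual_linear_on_cube)
        (auto simp: g_fun_def sum_divide_distrib)
    also have "(\<Sum>k\<in>?P. \<bar>?u k - 1 / (2 * ?m)\<bar>)
        = (\<Sum>(i, j)\<in>?P. \<bar>w \<bullet> (x i - x j) - 1 / 2\<bar>) / ?m"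
      unfolding sum_divide_distrib
    proof (intro sum.cong refl, clarify)
      fix i j assume ij: "(i, j) \<in> ?P"
      \<comment> \<open>The columns and the coefficients of \<open>g_fun\<close> carry the same
        factor 1/m, which is pulled out here.\<close>
      have "?u (i, j) - 1 / (2 * ?m) = (w \<bullet> (x i - x j) - 1 / 2) / ?m"
        using ij by (simp add: transpose_vec_def A_mat_def inner_commute diff_divide_distrib)
      then show "\<bar>?u (i, j) - 1 / (2 * ?m)\<bar> = \<bar>w \<bullet> (x i - x j) - 1 / 2\<bar> / ?m"
        using m by simp
    qed
    finally show "ereal (R_emp n x y w) = ereal (1 / 2) + fenchel_dual ?P (g_fun n y) ?u"
      using R_emp_eq[OF P, of x w] by simp
  }
  have "mat_norm ?P (A_mat n x y) \<le> sqrt (real (card ?P)) * (2 * R / ?m)"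
  proof (rule mat_norm_le[OF finite_pairs P])
    fix k assume k: "k \<in> ?P"
    obtain i j where ij: "k = (i, j)" by fastforce
    have "norm (x i - x j) \<le> norm (x i) + norm (x j)" by (rule norm_triangle_ineq4)
    also have "\<dots> \<le> R + R"
      using k ij by (intro add_mono assms(1)) (auto simp: pairs_def pos_idx_def neg_idx_def)
    finally show "norm (A_mat n x y k) \<le> 2 * R / ?m"
      using k m by (simp add: A_mat_def ij divide_right_mono)
  qed
  then have "sqrt (D_max n y) * mat_norm ?P (A_mat n x y)
      \<le> sqrt (?m / 2) * (sqrt ?m * (2 * R / ?m))"
    unfolding D_max_eq card_pairs by (intro mult_left_mono) auto
  also have "\<dots> = sqrt 2 * R"
  proof -
    \<comment> \<open>One factor \<open>sqrt ?m\<close> comes from D and one from the number of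
      columns; together they cancel the 1/m in the column bound.\<close>
    have "sqrt (?m / 2) * (sqrt ?m * (2 * R / ?m)) = (sqrt ?m * sqrt ?m) * (2 / sqrt 2) * (R / ?m)"
      by (simp only: real_sqrt_divide times_divide_eq_left times_divide_eq_right
          divide_divide_eq_left mult_ac)
    also have "2 / sqrt 2 = sqrt 2" by (rule real_div_sqrt) simp
    finally show ?thesis using m by simp
  qed
  finally show "sqrt (D_max n y) * mat_norm ?P (A_mat n x y) \<le> sqrt 2 * R" .
qed

end
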